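(* Let $L:\mathsf{T}(\mathsf{S}^2)^n\to\mathbb{R}$ be a Lagrangian whose Legendre transformation $\mu_i=(I_3-q_iq_i^T)\frac{\partial L(q,\dot q)}{\partial\dot q_i}$, $i=1,\dots,n$, is invertible as a map $\dot q\in\mathsf{T}_q(\mathsf{S}^2)^n\mapsto\mu\in\mathsf{T}^*_q(\mathsf{S}^2)^n$, and let $H:\mathsf{T}^*(\mathsf{S}^2)^n\to\mathbb{R}$ be the Hamiltonian $H(q,\mu)=\sum_{i=1}^n\mu_i\cdot\dot q_i-L(q,\dot q)$, with the right-hand side expressed in terms of $(q,\mu)$ through the Legendre transformation. Let $f_i\in\mathbb{R}^3$ be the generalized force acting on $q_i$. Hamilton's equations on $(\mathsf{S}^2)^n$ are $$\dot q_i=(I_3-q_iq_i^T)\frac{\partial H(q,\mu)}{\partial\mu_i},$$ $$\dot\mu_i=-(I_3-q_iq_i^T)\left(\frac{\partial H(q,\mu)}{\partial q_i}-f_i\right)+\frac{\partial H(q,\mu)}{\partial\mu_i}\times(\mu_i\times q_i),$$ for $i=1,\dots,n$. That is, a curve $(q,\mu):[t_0,t_f]\to\mathsf{T}^*(\mathsf{S}^2)^n$ satisfies Hamilton's phase space variational principle $\delta\mathfrak{G}=-\delta\mathcal{W}$ for all admissible variations if and only if these equations hold along it.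
   Context: $\mathsf{S}^2=\{q\in\mathbb{R}^3:\|q\|=1\}$, $\mathsf{T}_q\mathsf{S}^2=\{\xi\in\mathbb{R}^3: q\cdot\xi=0\}$, $I_3$ is the $3\times3$ identity matrix, and $S(x)y=x\times y$ defines the skew-symmetric matrix $S(x)$. The cotangent space $\mathsf{T}^*_{q}\mathsf{S}^2$ is identified with $\mathsf{T}_q\mathsf{S}^2$ by the dot product, so $\mathsf{T}^*(\mathsf{S}^2)^n=\{(q,\mu)\in\mathbb{R}^{3n}\times\mathbb{R}^{3n}: \|q_i\|=1,\ q_i\cdot\mu_i=0\}$. All functions and curves are assumed sufficiently smooth. $L$ and $H$ are regarded as (restrictions of) smooth functions on an open neighborhood in $\mathbb{R}^{3n}\times\mathbb{R}^{3n}$, and $\partial L/\partial\dot q_i$, $\partial H/\partial q_i$, $\partial H/\partial\mu_i\in\mathbb{R}^3$ are the ordinary gradients there. The action is $\mathfrak{G}=\int_{t_0}^{t_f}\left\{\sum_{i=1}^n\mu_i\cdot\dot q_i-H(q,\mu)\right\}dt$ and $\delta\mathfrak{G}$ is its first variation. Admissible variations: $\delta q_i=S(\gamma_i)q_i$, with $\gamma_i:[t_0,t_f]\to\mathbb{R}^3$ continuously differentiable, $\gamma_i(t_0)=\gamma_i(t_f)=0$, $\gamma_i\cdot q_i=0$; and $\delta\mu_i:[t_0,t_f]\to\mathbb{R}^3$ subject only to $\delta q_i\cdot\mu_i+q_i\cdot\delta\mu_i=0$ (the linearization of $q_i\cdot\mu_i=0$), so that its component $(I_3-q_iq_i^T)\delta\mu_i$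 is otherwise unconstrained. The virtual work of the generalized forces (given continuous $\mathbb{R}^3$-valued functions along the motion) is $\sum_i f_i\cdot\delta q_i$, and $\delta\mathcal{W}=\int_{t_0}^{t_f}\sum_{i=1}^n f_i\cdot\delta q_i\,dt$. Hamilton's equations are the equations characterizing the curves in $\mathsf{T}^*(\mathsf{S}^2)^n$ satisfying $\delta\mathfrak{G}=-\delta\mathcal{W}$ for all admissible variations. *)

theory Defs
  imports "HOL-Analysis.Analysis"
begin

text \<open>Points of $\mathbb{R}^{3n}$ have type \<^typ>\<open>real^3^'n\<close>, with \<open>n = CARD('n)\<close>; the
  block \<open>q $ i\<close> is the vector $q_i \in \mathbb{R}^3$. The vector
  $S(x)y = x \times y$ is \<open>cross3 x y\<close>.\<close>

section \<open>The bundles\<close>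

definition tangent_space :: "real^3^'n \<Rightarrow> (real^3^'n) set"
  where "tangent_space q = {v. \<forall>i. q $ i \<bullet> v $ i = 0}"

definition tangent_bundle :: "((real^3^'n) \<times> (real^3^'n)) set"
  where "tangent_bundle = {(q, v). (\<forall>i. norm (q $ i) = 1) \<and> v \<in> tangent_space q}"

text \<open>Covectors are identified with tangent vectors by the dot product.\<close>

abbreviation cotangent_space :: "real^3^'n \<Rightarrow> (real^3^'n) set"
  where "cotangent_space \<equiv> tangent_space"

abbreviation cotangent_bundle :: "((real^3^'n) \<times> (real^3^'n)) set"
  where "cotangent_bundle \<equiv> tangent_bundle"

text \<open>The matrix $I_3 - qq^T$.\<close>

definition proj :: "real^3 \<Rightarrow> real^3^3"
  where "proj q = mat 1 - (\<chi> j k. q $ j * q $ k)"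

section \<open>Smoothness and gradients\<close>

definition gradient :: "('a::real_inner \<Rightarrow> real) \<Rightarrow> 'a \<Rightarrow> 'a"
  where "gradient F x = (THE D. GDERIV F x :> D)"

text \<open>``Sufficiently smooth'' is read as $C^1$, for functions on an open neighborhood of \<open>S\<close>
  and for curves on a compact interval (with one-sided derivatives at its end points).\<close>

definition C1_near :: "'a::real_inner set \<Rightarrow> ('a \<Rightarrow> real) \<Rightarrow> bool"
  where "C1_near S F \<longleftrightarrow> (\<exists>U. open U \<and> S \<subseteq> U \<and>
     (\<forall>x\<in>U. GDERIV F x :> gradient F x) \<and> continuous_on U (gradient F))"

definition C1_curve :: "real \<Rightarrow> real \<Rightarrow> (real \<Rightarrow> 'a::real_normed_vector) \<Rightarrow> bool"
  where "C1_curve t0 tf x \<longleftrightarrow> (\<exists>x'. continuous_on {t0..tf} x' \<and>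
     (\<forall>t\<in>{t0..tf}. (x has_vector_derivative x' t) (at t within {t0..tf})))"

text \<open>For a function of a pair of points of $\mathbb{R}^{3n}$: the gradients in $\mathbb{R}^3$
  with respect to the \<open>i\<close>-th block of the first and of the second argument.\<close>

definition grad_fst ::
    "((real^3^'n) \<times> (real^3^'n) \<Rightarrow> real) \<Rightarrow> (real^3^'n) \<times> (real^3^'n) \<Rightarrow> 'n \<Rightarrow> real^3"
  where "grad_fst F z i = fst (gradient F z) $ i"

definition grad_snd ::
    "((real^3^'n) \<times> (real^3^'n) \<Rightarrow> real) \<Rightarrow> (real^3^'n) \<times> (real^3^'n) \<Rightarrow> 'n \<Rightarrow> real^3"
  where "grad_snd F z i = snd (gradient F z) $ i"

section \<open>Legendre transformation and Hamiltonian\<close>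

definition legendre ::
    "((real^3^'n) \<times> (real^3^'n) \<Rightarrow> real) \<Rightarrow> real^3^'n \<Rightarrow> real^3^'n \<Rightarrow> real^3^'n"
  where "legendre L q v = (\<chi> i. proj (q $ i) *v grad_snd L (q, v) i)"

definition legendre_invertible :: "((real^3^'n) \<times> (real^3^'n) \<Rightarrow> real) \<Rightarrow> bool"
  where "legendre_invertible L \<longleftrightarrow> (\<forall>q. (\<forall>i. norm (q $ i) = 1) \<longrightarrow>
     bij_betw (legendre L q) (tangent_space q) (cotangent_space q))"

text \<open>\<open>H\<close> is given on a neighborhood, but only its restriction to the cotangent bundle is
  determined by \<open>L\<close>; the extension is arbitrary.\<close>

definition is_hamiltonian_of ::
    "((real^3^'n) \<times> (real^3^'n) \<Rightarrow> real) \<Rightarrow> ((real^3^'n) \<times> (real^3^'n) \<Rightarrow> real) \<Rightarrow> bool"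
  where "is_hamiltonian_of H L \<longleftrightarrow> (\<forall>(q, \<mu>) \<in> cotangent_bundle.
     H (q, \<mu>) = (let v = the_inv_into (tangent_space q) (legendre L q) \<mu>
                 in (\<Sum>i\<in>UNIV. \<mu> $ i \<bullet> v $ i) - L (q, v)))"

section \<open>The phase space variational principle\<close>

definition action ::
    "((real^3^'n) \<times> (real^3^'n) \<Rightarrow> real) \<Rightarrow> real \<Rightarrow> real \<Rightarrow>
     (real \<Rightarrow> real^3^'n) \<Rightarrow> (real \<Rightarrow> real^3^'n) \<Rightarrow> real"
  where "action H t0 tf q \<mu> = integral {t0..tf} (\<lambda>t.
     (\<Sum>i\<in>UNIV. \<mu> t $ i \<bullet> vector_derivative q (at t within {t0..tf}) $ i) - H (q t, \<mu> t))"

text \<open>The first variation is the derivative of the action along \<open>(q + \<epsilon> \<delta>q, \<mu> + \<epsilon> \<delta>\<mu>)\<close> at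
  \<open>\<epsilon> = 0\<close>. For small \<open>\<epsilon>\<close> this curve remains in the neighborhood of the cotangent bundle on
  which \<open>H\<close> is smooth.\<close>

definition has_first_variation ::
    "((real^3^'n) \<times> (real^3^'n) \<Rightarrow> real) \<Rightarrow> real \<Rightarrow> real \<Rightarrow>
     (real \<Rightarrow> real^3^'n) \<Rightarrow> (real \<Rightarrow> real^3^'n) \<Rightarrow>
     (real \<Rightarrow> real^3^'n) \<Rightarrow> (real \<Rightarrow> real^3^'n) \<Rightarrow> real \<Rightarrow> bool"
  where "has_first_variation H t0 tf q \<mu> \<delta>q \<delta>\<mu> \<delta>G \<longleftrightarrow>
     ((\<lambda>\<epsilon>. action H t0 tf (\<lambda>t. q t + \<epsilon> *\<^sub>R \<delta>q t) (\<lambda>t. \<mu> t + \<epsilon> *\<^sub>R \<delta>\<mu> t))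
        has_real_derivative \<delta>G) (at 0)"

definition virtual_work ::
    "(real \<Rightarrow> real^3^'n) \<Rightarrow> real \<Rightarrow> real \<Rightarrow> (real \<Rightarrow> real^3^'n) \<Rightarrow> real"
  where "virtual_work f t0 tf \<delta>q = integral {t0..tf} (\<lambda>t. \<Sum>i\<in>UNIV. f t $ i \<bullet> \<delta>q t $ i)"

definition admissible_variation ::
    "real \<Rightarrow> real \<Rightarrow> (real \<Rightarrow> real^3^'n) \<Rightarrow> (real \<Rightarrow> real^3^'n) \<Rightarrow>
     (real \<Rightarrow> real^3^'n) \<Rightarrow> (real \<Rightarrow> real^3^'n) \<Rightarrow> bool"
  where "admissible_variation t0 tf q \<mu> \<delta>q \<delta>\<mu> \<longleftrightarrow>
     (\<exists>\<gamma>. C1_curve t0 tf \<gamma> \<and> \<gamma> t0 = 0 \<and> \<gamma> tf = 0 \<and>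
        (\<forall>t\<in>{t0..tf}. \<forall>i. \<gamma> t $ i \<bullet> q t $ i = 0 \<and> \<delta>q t $ i = cross3 (\<gamma> t $ i) (q t $ i))) \<and>
     continuous_on {t0..tf} \<delta>\<mu> \<and>
     (\<forall>t\<in>{t0..tf}. \<forall>i. \<delta>q t $ i \<bullet> \<mu> t $ i + q t $ i \<bullet> \<delta>\<mu> t $ i = 0)"

definition phase_space_principle ::
    "((real^3^'n) \<times> (real^3^'n) \<Rightarrow> real) \<Rightarrow> (real \<Rightarrow> real^3^'n) \<Rightarrow> real \<Rightarrow> real \<Rightarrow>
     (real \<Rightarrow> real^3^'n) \<Rightarrow> (real \<Rightarrow> real^3^'n) \<Rightarrow> bool"
  where "phase_space_principle H f t0 tf q \<mu> \<longleftrightarrow>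
     (\<forall>\<delta>q \<delta>\<mu>. admissible_variation t0 tf q \<mu> \<delta>q \<delta>\<mu> \<longrightarrow>
        has_first_variation H t0 tf q \<mu> \<delta>q \<delta>\<mu> (- virtual_work f t0 tf \<delta>q))"

end

theory Submission
  imports Defs
begin

text \<open>
  Along the curve the first variation exists for every admissible variation and is obtained by
  differentiating under the integral sign. Integrating \<open>\<mu> \<bullet> \<delta>q'\<close> by parts, where the boundary terms
  vanish because \<open>\<gamma>\<close> does, the principle \<open>\<delta>G = - \<delta>W\<close> becomes

  \<open>\<integral> \<Sum>\<^sub>i \<delta>\<mu>\<^sub>i \<bullet> (q\<^sub>i' - \<partial>H/\<partial>\<mu>\<^sub>i) + \<delta>q\<^sub>i \<bullet> (f\<^sub>i - \<partial>H/\<partial>q\<^sub>i - \<mu>\<^sub>i') = 0.\<close>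

  Here \<open>\<delta>\<mu>\<close> and \<open>\<delta>q\<close> are coupled: the component of \<open>\<delta>\<mu>\<^sub>i\<close> along \<open>q\<^sub>i\<close> must equal
  \<open>- \<delta>q\<^sub>i \<bullet> \<mu>\<^sub>i\<close>. Eliminating that component leaves an integrand \<open>V \<bullet> \<delta>\<mu> + R \<bullet> \<delta>q\<close> whose
  coefficients are tangent to the spheres:

  \<open>V\<^sub>i = q\<^sub>i' - P\<^sub>i \<partial>H/\<partial>\<mu>\<^sub>i\<close> and
  \<open>R\<^sub>i = P\<^sub>i (f\<^sub>i - \<partial>H/\<partial>q\<^sub>i - \<mu>\<^sub>i') + (q\<^sub>i \<bullet> \<partial>H/\<partial>\<mu>\<^sub>i) \<mu>\<^sub>i\<close>, with \<open>P\<^sub>i = I - q\<^sub>i q\<^sub>i\<^sup>T\<close>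

  (\<open>phase_space_principle_iff_weak_form\<close>). Since tangent variations of both kinds can now be
  chosen freely, the principle holds if and only if \<open>V = 0\<close> and \<open>R = 0\<close> on the whole interval
  (\<open>admissible_variations_separate\<close>, which rests on \<open>fundamental_lemma_C1\<close>).

  It remains to compare \<open>V = R = 0\<close> with Hamilton's equations (\<open>residuals_eq_0_iff\<close>).
  \<open>R\<^sub>i = 0\<close> gives only the tangential part of \<open>\<mu>\<^sub>i'\<close>. Its normal part is dictated by
  the derivative of \<open>q\<^sub>i \<bullet> \<mu>\<^sub>i = 0\<close>, namely
  \<open>q\<^sub>i \<bullet> \<mu>\<^sub>i' = - q\<^sub>i' \<bullet> \<mu>\<^sub>i = - \<partial>H/\<partial>\<mu>\<^sub>i \<bullet> \<mu>\<^sub>i\<close>. Together with the term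
  \<open>(q\<^sub>i \<bullet> \<partial>H/\<partial>\<mu>\<^sub>i) \<mu>\<^sub>i\<close> this is the Lagrange expansion of
  \<open>\<partial>H/\<partial>\<mu>\<^sub>i \<times> (\<mu>\<^sub>i \<times> q\<^sub>i)\<close>.
\<close>

section \<open>Projection, cross product and derivatives of blocks\<close>

lemma proj_mult_vec: "proj u *v x = x - (u \<bullet> x) *\<^sub>R u"
proof -
  have "(\<chi> j k. u $ j * u $ k) *v x = (u \<bullet> x) *\<^sub>R u"
    by (simp add: matrix_vector_mult_def vec_eq_iff inner_vec_def sum_distrib_left
        mult_ac)
  then show ?thesis
    by (simp add: proj_def matrix_vector_mult_diff_rdistrib)
qed

lemma inner_blocks: "x \<bullet> y = (\<Sum>i\<in>UNIV. x $ i \<bullet> y $ i)" for x y :: "real^3^'n"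
  by (rule inner_vec_def)

lemma blocks_eq_0_iff: "x = 0 \<longleftrightarrow> (\<forall>i. x $ i = 0)" for x :: "real^3^'n"
  by (metis vec_eq_iff zero_index)

lemma has_vector_derivative_vec_nth:
  assumes "(x has_vector_derivative x') F"
  shows "((\<lambda>s. x s $ i) has_vector_derivative x' $ i) F"
  using bounded_linear.has_vector_derivative[OF bounded_linear_vec_nth assms] .

lemma has_vector_derivative_vec_lambda:
  fixes x :: "real \<Rightarrow> 'a::real_normed_vector^'n"
  assumes "\<And>i. ((\<lambda>s. x s $ i) has_vector_derivative x' $ i) (at t within T)"
  shows "(x has_vector_derivative x') (at t within T)"
  unfolding has_vector_derivative_def has_derivative_within
proof (intro conjI bounded_linear_scaleR_left vec_tendstoI)
  fix i
  show "((\<lambda>y. ((1 / norm (y - t)) *\<^sub>R (x y - (x t + (y - t) *\<^sub>R x'))) $ i) \<longlongrightarrow> 0 $ i)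
      (at t within T)"
    using assms[of i] unfolding has_vector_derivative_def has_derivative_within by simp
qed

lemma C1_curve_vec_lambda:
  fixes x :: "real \<Rightarrow> real^3^'n"
  assumes "continuous_on {a..b} x'"
    and "\<And>t i. t \<in> {a..b} \<Longrightarrow> ((\<lambda>s. x s $ i) has_vector_derivative x' t $ i) (at t within {a..b})"
  shows "C1_curve a b x"
  using assms has_vector_derivative_vec_lambda[of x _ _ "{a..b}"] unfolding C1_curve_def by blast

lemma bounded_bilinear_cross3: "bounded_bilinear cross3"
  using bilinear_conv_bounded_bilinear bilinear_cross by blast

declare continuous_on_cross [continuous_intros]

section \<open>The fundamental lemma of the calculus of variations\<close>

text \<open>The ideal test function would be \<open>w C\<close>, where the weight \<open>w t = (t - a) (b - t)\<close> vanishes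
  at both ends and is positive between them, but \<open>C\<close> is merely continuous. By the theorem of
  Weierstrass a polynomial \<open>p\<close> approximates \<open>C\<close> uniformly, and \<open>w p\<close> is an allowed test function;
  in the limit \<open>\<integral> w \<bar>C\<bar>\<^sup>2 = 0\<close>.\<close>

lemma fundamental_lemma_C1:
  fixes C :: "real \<Rightarrow> 'a::euclidean_space"
  assumes "a < b" and C: "continuous_on {a..b} C"
    and orth: "\<And>\<eta>. C1_curve a b \<eta> \<Longrightarrow> \<eta> a = 0 \<Longrightarrow> \<eta> b = 0 \<Longrightarrow> integral {a..b} (\<lambda>t. C t \<bullet> \<eta> t) = 0"
    and t: "t \<in> {a..b}"
  shows "C t = 0"
proof -
  define w where "w t = (t - a) * (b - t)" for t
  have w: "w t \<ge> 0" if "t \<in> {a..b}" for t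
    using that by (simp add: w_def)
  have wc: "continuous_on S w" for S
    unfolding w_def by (intro continuous_intros)
  define I where "I = integral {a..b} (\<lambda>t. w t * (C t \<bullet> C t))"
  define M where "M = integral {a..b} (\<lambda>t. w t * norm (C t))"
  have Mint: "(\<lambda>t. w t * norm (C t)) integrable_on {a..b}"
    by (intro integrable_continuous_real continuous_intros wc C)
  have M: "M \<ge> 0"
    unfolding M_def using w by (intro integral_nonneg Mint) auto
  have le: "I \<le> e * M" if "e > 0" for e
  proof -
    obtain p where p: "polynomial_function p" "\<And>t. t \<in> {a..b} \<Longrightarrow> norm (C t - p t) < e"
      using Stone_Weierstrass_polynomial_function[OF compact_Icc C \<open>e > 0\<close>] by blast
    obtain p' where p': "polynomial_function p'" "\<And>t. (p has_vector_derivative p' t) (at t)"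
      using has_vector_derivative_polynomial_function[OF p(1)] by blast
    have pc: "continuous_on S p" "continuous_on S p'" for S
      using p p' by (auto intro: continuous_on_polymonial_function)
    have "C1_curve a b (\<lambda>t. w t *\<^sub>R p t)"
      unfolding C1_curve_def
    proof (intro exI conjI ballI)
      show "continuous_on {a..b} (\<lambda>t. w t *\<^sub>R p' t + (b - t - (t - a)) *\<^sub>R p t)"
        by (intro continuous_intros wc pc)
      show "((\<lambda>t. w t *\<^sub>R p t) has_vector_derivative
          w t *\<^sub>R p' t + (b - t - (t - a)) *\<^sub>R p t) (at t within {a..b})" for t
      proof -
        have "(w has_vector_derivative b - t - (t - a)) (at t within {a..b})"
          unfolding w_def has_real_derivative_iff_has_vector_derivative[symmetric]
          by (auto intro!: derivative_eq_intros)
        then show ?thesis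
          by (rule bounded_bilinear.has_vector_derivative[OF bounded_bilinear_scaleR])
            (rule has_vector_derivative_at_within[OF p'(2)])
      qed
    qed
    from orth[OF this] have "integral {a..b} (\<lambda>t. C t \<bullet> (w t *\<^sub>R p t)) = 0"
      by (simp add: w_def)
    then have "I = integral {a..b} (\<lambda>t. w t * (C t \<bullet> C t)) - integral {a..b} (\<lambda>t. C t \<bullet> (w t *\<^sub>R p t))"
      by (simp add: I_def)
    also have "\<dots> = integral {a..b} (\<lambda>t. w t * (C t \<bullet> (C t - p t)))"
      by (subst integral_diff[symmetric])
        (auto intro!: integrable_continuous_real continuous_intros wc C pc simp: inner_diff_right algebra_simps)
    also have "\<dots> \<le> integral {a..b} (\<lambda>t. e * (w t * norm (C t)))"
    proof (rule integral_le)
      fix t assume t: "t \<in> {a..b}"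
      have "C t \<bullet> (C t - p t) \<le> norm (C t) * norm (C t - p t)"
        by (rule norm_cauchy_schwarz)
      also have "\<dots> \<le> norm (C t) * e"
        using p(2)[OF t] by (intro mult_left_mono) auto
      finally have "C t \<bullet> (C t - p t) \<le> norm (C t) * e" .
      from mult_left_mono[OF this w[OF t]]
      show "w t * (C t \<bullet> (C t - p t)) \<le> e * (w t * norm (C t))"
        by (simp add: mult_ac)
    qed (auto intro!: integrable_continuous_real continuous_intros wc C pc)
    finally show ?thesis
      by (simp add: M_def)
  qed
  \<comment> \<open>The shift by 1 avoids a division by zero when \<open>M = 0\<close>.\<close>
  have "I \<le> 0"
  proof (rule field_le_epsilon)
    fix e :: real assume "e > 0"
    have "I \<le> e / (M + 1) * M"
      using \<open>e > 0\<close> M by (intro le) auto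
    also have "\<dots> \<le> e"
      using \<open>e > 0\<close> M by (simp add: field_simps)
    finally show "I \<le> 0 + e" by simp
  qed
  moreover have "I \<ge> 0"
    unfolding I_def using w
    by (intro integral_nonneg integrable_continuous_real continuous_intros wc C) auto
  ultimately have "\<forall>t\<in>{a..b}. w t * (C t \<bullet> C t) = 0"
    unfolding I_def using w \<open>a < b\<close>
    by (subst integral_eq_0_iff[symmetric]) (auto intro!: continuous_intros wc C)
  then have "C t = 0" if "t \<in> {a<..<b}" for t
    using that by (force simp: w_def)
  \<comment> \<open>At the end points, where \<open>w\<close> vanishes, continuity takes over.\<close>
  moreover have cl: "closure {a<..<b} = {a..b}"
    using \<open>a < b\<close> by simp
  ultimately show ?thesis
    using continuous_constant_on_closure[of "{a<..<b}" C 0 t] C t by auto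
qed

section \<open>The first variation of the action\<close>

text \<open>The integrand of the varied action is continuously differentiable in \<open>\<epsilon>\<close>, so that Leibniz's
  rule applies, as long as the varied curve stays in the neighbourhood where \<open>H\<close> is smooth. By
  compactness of the time interval this is the case for all \<open>\<epsilon>\<close> in an interval around 0 that does
  not depend on the time.\<close>

lemma first_variation_formula:
  fixes H :: "(real^3^'n) \<times> (real^3^'n) \<Rightarrow> real"
  assumes "t0 < tf" and H: "C1_near S H" and S: "\<And>t. t \<in> {t0..tf} \<Longrightarrow> (q t, \<mu> t) \<in> S"
    and q: "\<And>t. t \<in> {t0..tf} \<Longrightarrow> (q has_vector_derivative q' t) (at t within {t0..tf})"
    and dq: "\<And>t. t \<in> {t0..tf} \<Longrightarrow> (\<delta>q has_vector_derivative \<delta>q' t) (at t within {t0..tf})"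
    and cont: "continuous_on {t0..tf} q'" "continuous_on {t0..tf} \<delta>q'"
      "continuous_on {t0..tf} \<mu>" "continuous_on {t0..tf} \<delta>\<mu>"
  shows "has_first_variation H t0 tf q \<mu> \<delta>q \<delta>\<mu> (integral {t0..tf}
    (\<lambda>t. \<delta>\<mu> t \<bullet> q' t + \<mu> t \<bullet> \<delta>q' t - gradient H (q t, \<mu> t) \<bullet> (\<delta>q t, \<delta>\<mu> t)))"
proof -
  let ?T = "{t0..tf}"
  define z where "z t = (q t, \<mu> t)" for t
  define \<zeta> where "\<zeta> t = (\<delta>q t, \<delta>\<mu> t)" for t
  have cq: "continuous_on ?T q" "continuous_on ?T \<delta>q"
    by (rule continuous_on_vector_derivative, erule q dq)+
  have cz: "continuous_on ?T z" "continuous_on ?T \<zeta>"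
    unfolding z_def \<zeta>_def by (intro continuous_intros cq cont)+
  obtain U where U: "open U" "S \<subseteq> U" "\<And>x. x \<in> U \<Longrightarrow> GDERIV H x :> gradient H x"
      "continuous_on U (gradient H)"
    using H unfolding C1_near_def by blast
  have HU: "continuous_on U H"
    using U(3) unfolding gderiv_def
    by (meson continuous_at_imp_continuous_on has_derivative_continuous)
  have "z ` ?T \<subseteq> U"
    using S U(2) by (auto simp: z_def)
  then obtain r where r: "r > 0" "(\<Union>x\<in>z ` ?T. ball x r) \<subseteq> U"
    using compact_subset_open_imp_ball_epsilon_subset[OF compact_continuous_image[OF cz(1)] U(1)]
    by blast
  obtain M where M: "M > 0" "\<And>t. t \<in> ?T \<Longrightarrow> norm (\<zeta> t) \<le> M"
    using compact_imp_bounded[OF compact_continuous_image[OF cz(2)]] unfolding bounded_pos by auto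
  \<comment> \<open>For these \<open>\<epsilon>\<close> the displacement \<open>\<epsilon> \<zeta>\<close> is shorter than the width \<open>r\<close> of a tube inside \<open>U\<close>.\<close>
  define E where "E = {- (r / M)<..<r / M}"
  have zU: "z t + e *\<^sub>R \<zeta> t \<in> U" if "e \<in> E" "t \<in> ?T" for e t
  proof -
    have "\<bar>e\<bar> * norm (\<zeta> t) \<le> \<bar>e\<bar> * M"
      using M that by (intro mult_left_mono) auto
    also have "\<dots> < r"
      using that(1) M(1) by (auto simp: E_def field_simps abs_less_iff)
    finally have "z t + e *\<^sub>R \<zeta> t \<in> ball (z t) r"
      by (simp add: dist_norm)
    then show ?thesis
      using r(2) that(2) by blast
  qed
  define F where "F e t = (\<mu> t + e *\<^sub>R \<delta>\<mu> t) \<bullet> (q' t + e *\<^sub>R \<delta>q' t) - H (z t + e *\<^sub>R \<zeta> t)" for e t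
  define F' where "F' e t = \<delta>\<mu> t \<bullet> (q' t + e *\<^sub>R \<delta>q' t) + (\<mu> t + e *\<^sub>R \<delta>\<mu> t) \<bullet> \<delta>q' t
      - gradient H (z t + e *\<^sub>R \<zeta> t) \<bullet> \<zeta> t" for e t
  have action: "action H t0 tf (\<lambda>t. q t + e *\<^sub>R \<delta>q t) (\<lambda>t. \<mu> t + e *\<^sub>R \<delta>\<mu> t) = integral ?T (F e)" for e
    unfolding action_def
  proof (rule integral_cong)
    fix t assume t: "t \<in> ?T"
    have "((\<lambda>t. q t + e *\<^sub>R \<delta>q t) has_vector_derivative q' t + e *\<^sub>R \<delta>q' t) (at t within ?T)"
      using q[OF t] dq[OF t] by (auto intro!: derivative_eq_intros)
    then have "vector_derivative (\<lambda>t. q t + e *\<^sub>R \<delta>q t) (at t within ?T) = q' t + e *\<^sub>R \<delta>q' t"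
      using vector_derivative_within_cbox[of t0 tf t] t \<open>t0 < tf\<close> by auto
    then show "(\<Sum>i\<in>UNIV. (\<mu> t + e *\<^sub>R \<delta>\<mu> t) $ i \<bullet>
        vector_derivative (\<lambda>t. q t + e *\<^sub>R \<delta>q t) (at t within ?T) $ i)
        - H (q t + e *\<^sub>R \<delta>q t, \<mu> t + e *\<^sub>R \<delta>\<mu> t) = F e t"
      by (simp only: F_def inner_blocks) (simp add: z_def \<zeta>_def)
  qed
  have deriv: "((\<lambda>e. F e t) has_field_derivative F' e t) (at e within E)" if "e \<in> E" "t \<in> ?T" for e t
  proof -
    have "(H has_derivative (\<lambda>h. h \<bullet> gradient H (z t + e *\<^sub>R \<zeta> t))) (at (z t + e *\<^sub>R \<zeta> t))"
      using U(3)[OF zU[OF that]] by (simp add: gderiv_def)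
    moreover have "((\<lambda>e. z t + e *\<^sub>R \<zeta> t) has_derivative (\<lambda>h. h *\<^sub>R \<zeta> t)) (at e)"
      by (auto intro!: derivative_eq_intros)
    ultimately have dH: "((\<lambda>e. H (z t + e *\<^sub>R \<zeta> t)) has_derivative
        (\<lambda>h. (h *\<^sub>R \<zeta> t) \<bullet> gradient H (z t + e *\<^sub>R \<zeta> t))) (at e)"
      by (rule has_derivative_compose[rotated])
    have "((\<lambda>e. F e t) has_derivative (\<lambda>h. F' e t * h)) (at e)"
      unfolding F_def F'_def
      by (auto intro!: derivative_eq_intros dH simp: inner_commute algebra_simps)
    then show ?thesis
      unfolding has_field_derivative_def by (rule has_derivative_at_withinI)
  qed
  have cF: "continuous_on ?T (F e)" if "e \<in> E" for e
  proof -
    have "continuous_on ?T (\<lambda>t. H (z t + e *\<^sub>R \<zeta> t))"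
      by (rule continuous_on_compose2[OF HU]) (use zU that in \<open>auto intro!: continuous_intros cz\<close>)
    then show ?thesis
      unfolding F_def by (intro continuous_intros cont)
  qed
  have cF': "continuous_on (Sigma E (\<lambda>_. ?T)) (\<lambda>(e, t). F' e t)"
  proof -
    let ?P = "Sigma E (\<lambda>_. ?T)"
    have *: "continuous_on ?P (\<lambda>x. g (snd x))" if "continuous_on ?T g" for g :: "real \<Rightarrow> 'z::topological_space"
      by (rule continuous_on_compose2[OF that]) (auto intro!: continuous_intros)
    have "continuous_on ?P (\<lambda>x. gradient H (z (snd x) + fst x *\<^sub>R \<zeta> (snd x)))"
      by (rule continuous_on_compose2[OF U(4)])
        (use zU in \<open>auto intro!: continuous_intros * cz\<close>)
    then show ?thesis
      unfolding F'_def split_beta by (intro continuous_intros * cont cz)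
  qed
  have "0 \<in> E"
    using r M by (simp add: E_def)
  have "((\<lambda>e. integral (cbox t0 tf) (F e)) has_field_derivative integral (cbox t0 tf) (F' 0))
      (at 0 within E)"
    by (rule leibniz_rule_field_derivative)
      (use deriv cF cF' \<open>0 \<in> E\<close> in \<open>auto intro!: integrable_continuous_real simp: E_def\<close>)
  then have "((\<lambda>e. integral ?T (F e)) has_field_derivative integral ?T (F' 0)) (at 0)"
    using \<open>0 \<in> E\<close> by (simp add: E_def at_within_open[OF _ open_greaterThanLessThan])
  moreover have "F' 0 = (\<lambda>t. \<delta>\<mu> t \<bullet> q' t + \<mu> t \<bullet> \<delta>q' t - gradient H (q t, \<mu> t) \<bullet> (\<delta>q t, \<delta>\<mu> t))"
    by (auto simp: F'_def z_def \<zeta>_def)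
  ultimately show ?thesis
    unfolding has_first_variation_def action by simp
qed

lemma integral_by_parts_vanishing:
  fixes x y :: "real \<Rightarrow> 'a::real_inner"
  assumes "a \<le> b"
    and x: "\<And>t. t \<in> {a..b} \<Longrightarrow> (x has_vector_derivative x' t) (at t within {a..b})"
    and y: "\<And>t. t \<in> {a..b} \<Longrightarrow> (y has_vector_derivative y' t) (at t within {a..b})"
    and cont: "continuous_on {a..b} x'" "continuous_on {a..b} y'"
    and ends: "y a = 0" "y b = 0"
  shows "integral {a..b} (\<lambda>t. x t \<bullet> y' t) = - integral {a..b} (\<lambda>t. x' t \<bullet> y t)"
proof -
  have c: "continuous_on {a..b} x" "continuous_on {a..b} y"
    by (rule continuous_on_vector_derivative, erule x y)+
  have "((\<lambda>t. x t \<bullet> y' t + x' t \<bullet> y t) has_integral x b \<bullet> y b - x a \<bullet> y a) {a..b}"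
    using x y
    by (intro fundamental_theorem_of_calculus assms
        bounded_bilinear.has_vector_derivative[OF bounded_bilinear_inner])
  then have "integral {a..b} (\<lambda>t. x t \<bullet> y' t + x' t \<bullet> y t) = 0"
    using ends by (simp add: integral_unique)
  then show ?thesis
    by (subst (asm) integral_add) (auto intro!: integrable_continuous_real continuous_intros c cont)
qed

section \<open>Residuals of Hamilton's equations\<close>

text \<open>The two residuals are the coefficients of \<open>\<delta>\<mu>\<close> and of \<open>\<delta>q\<close> in the variation, after the
  component of \<open>\<delta>\<mu>\<close> normal to the sphere has been eliminated by means of the linearized
  constraint. The arguments \<open>v\<close> and \<open>w\<close> are the velocities of \<open>q\<close> and \<open>\<mu>\<close>.\<close>

definition velocity_residual ::
    "((real^3^'n) \<times> (real^3^'n) \<Rightarrow> real) \<Rightarrow> real^3^'n \<Rightarrow> real^3^'n \<Rightarrow> real^3^'n \<Rightarrow> real^3^'n"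
  where "velocity_residual H q \<mu> v = (\<chi> i. v $ i - proj (q $ i) *v grad_snd H (q, \<mu>) i)"

definition force_residual ::
    "((real^3^'n) \<times> (real^3^'n) \<Rightarrow> real) \<Rightarrow> real^3^'n \<Rightarrow> real^3^'n \<Rightarrow> real^3^'n \<Rightarrow> real^3^'n \<Rightarrow> real^3^'n"
  where "force_residual H q \<mu> w f = (\<chi> i.
    proj (q $ i) *v (f $ i - grad_fst H (q, \<mu>) i - w $ i)
    + (q $ i \<bullet> grad_snd H (q, \<mu>) i) *\<^sub>R \<mu> $ i)"

lemma residuals_tangent:
  assumes "(q, \<mu>) \<in> cotangent_bundle" and "\<And>i. q $ i \<bullet> v $ i = 0"
  shows "velocity_residual H q \<mu> v \<in> tangent_space q"
    and "force_residual H q \<mu> w f \<in> tangent_space q"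
  using assms
  by (auto simp: velocity_residual_def force_residual_def tangent_bundle_def tangent_space_def
      proj_mult_vec inner_simps norm_eq_1)

text \<open>Here \<open>a\<close> and \<open>b\<close> are the values of \<open>\<delta>q\<close> and \<open>\<delta>\<mu>\<close>. Projecting \<open>\<partial>H/\<partial>\<mu>\<^sub>i\<close> drops
  its normal part, which pairs with \<open>b\<^sub>i\<close> to \<open>(q\<^sub>i \<bullet> \<partial>H/\<partial>\<mu>\<^sub>i) (q\<^sub>i \<bullet> b\<^sub>i)\<close>; replacing \<open>q\<^sub>i \<bullet> b\<^sub>i\<close> by
  \<open>- \<mu>\<^sub>i \<bullet> a\<^sub>i\<close> moves this product to the coefficient of \<open>a\<close>, where it becomes the last term of
  \<^const>\<open>force_residual\<close>.\<close>

lemma variation_integrand_eq_residuals: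
  fixes H :: "(real^3^'n) \<times> (real^3^'n) \<Rightarrow> real"
  assumes "(q, \<mu>) \<in> cotangent_bundle" and "\<And>i. q $ i \<bullet> a $ i = 0"
    and con: "\<And>i. a $ i \<bullet> \<mu> $ i + q $ i \<bullet> b $ i = 0"
  shows "b \<bullet> v - w \<bullet> a - gradient H (q, \<mu>) \<bullet> (a, b) + f \<bullet> a =
    velocity_residual H q \<mu> v \<bullet> b + force_residual H q \<mu> w f \<bullet> a"
proof -
  have "b $ i \<bullet> v $ i - w $ i \<bullet> a $ i - (grad_fst H (q, \<mu>) i \<bullet> a $ i + grad_snd H (q, \<mu>) i \<bullet> b $ i) + f $ i \<bullet> a $ i
      = velocity_residual H q \<mu> v $ i \<bullet> b $ i + force_residual H q \<mu> w f $ i \<bullet> a $ i" for i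
  proof -
    have "q $ i \<bullet> b $ i = - (\<mu> $ i \<bullet> a $ i)"
      using con[of i] by (simp add: inner_commute)
    then show ?thesis
      using assms(2)[of i]
      by (simp add: velocity_residual_def force_residual_def proj_mult_vec inner_simps inner_commute)
  qed
  then have "(\<Sum>i\<in>UNIV. b $ i \<bullet> v $ i - w $ i \<bullet> a $ i
       - (grad_fst H (q, \<mu>) i \<bullet> a $ i + grad_snd H (q, \<mu>) i \<bullet> b $ i) + f $ i \<bullet> a $ i)
      = (\<Sum>i\<in>UNIV. velocity_residual H q \<mu> v $ i \<bullet> b $ i + force_residual H q \<mu> w f $ i \<bullet> a $ i)"
    by simp
  moreover have "gradient H (q, \<mu>) \<bullet> (a, b) = fst (gradient H (q, \<mu>)) \<bullet> a + snd (gradient H (q, \<mu>)) \<bullet> b"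
    by (simp add: inner_prod_def)
  ultimately show ?thesis
    by (simp only: inner_blocks sum.distrib sum_subtractf grad_fst_def grad_snd_def)
qed

text \<open>The equation for \<open>w\<close> has three scalar components, while the vanishing of the tangent force
  residual has two; the third comes from the differentiated constraint \<open>v \<bullet> m + u \<bullet> w = 0\<close>, which
  yields \<open>u \<bullet> w = - h \<bullet> m\<close> once \<open>v\<close> is the projection of \<open>h\<close>.\<close>

lemma hamilton_block_iff:
  fixes u m v w g h f :: "real^3"
  assumes "norm u = 1" and um: "u \<bullet> m = 0" and con: "v \<bullet> m + u \<bullet> w = 0"
  shows "v = proj u *v h \<and> w = - (proj u *v (g - f)) + cross3 h (cross3 m u) \<longleftrightarrow>
    v - proj u *v h = 0 \<and> proj u *v (f - g - w) + (u \<bullet> h) *\<^sub>R m = 0"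
proof (cases "v = proj u *v h")
  case True
  then have "u \<bullet> w = - (h \<bullet> m)"
    using con um by (simp add: proj_mult_vec inner_simps)
  then show ?thesis
    using True
    by (auto simp: proj_mult_vec Lagrange inner_simps algebra_simps inner_commute)
qed auto

lemma residuals_eq_0_iff:
  assumes "(q, \<mu>) \<in> cotangent_bundle" and "\<And>i. v $ i \<bullet> \<mu> $ i + q $ i \<bullet> w $ i = 0"
  shows "velocity_residual H q \<mu> v = 0 \<and> force_residual H q \<mu> w f = 0 \<longleftrightarrow>
    (\<forall>i. v $ i = proj (q $ i) *v grad_snd H (q, \<mu>) i \<and>
         w $ i = - (proj (q $ i) *v (grad_fst H (q, \<mu>) i - f $ i))
           + cross3 (grad_snd H (q, \<mu>) i) (cross3 (\<mu> $ i) (q $ i)))"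
proof -
  have "norm (q $ i) = 1" "q $ i \<bullet> \<mu> $ i = 0" for i
    using assms(1) by (auto simp: tangent_bundle_def tangent_space_def)
  then have "v $ i = proj (q $ i) *v grad_snd H (q, \<mu>) i \<and>
         w $ i = - (proj (q $ i) *v (grad_fst H (q, \<mu>) i - f $ i))
           + cross3 (grad_snd H (q, \<mu>) i) (cross3 (\<mu> $ i) (q $ i)) \<longleftrightarrow>
      velocity_residual H q \<mu> v $ i = 0 \<and> force_residual H q \<mu> w f $ i = 0" for i
    unfolding velocity_residual_def force_residual_def vec_lambda_beta
    by (rule hamilton_block_iff[OF _ _ assms(2)])
  then show ?thesis
    unfolding blocks_eq_0_iff by blast
qed

section \<open>Constraints along the curve\<close>

text \<open>Used for \<open>q\<^sub>i \<bullet> q\<^sub>i = 1\<close> and \<open>q\<^sub>i \<bullet> \<mu>\<^sub>i = 0\<close>. The one-sided derivatives at the end points of the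
  interval are still unique, so the differentiated constraints hold there as well.\<close>

lemma constraint_derivative:
  fixes x y :: "real \<Rightarrow> 'a::real_inner"
  assumes "a < b" and t: "t \<in> {a..b}"
    and "(x has_vector_derivative x') (at t within {a..b})"
    and "(y has_vector_derivative y') (at t within {a..b})"
    and const: "\<And>s. s \<in> {a..b} \<Longrightarrow> x s \<bullet> y s = c"
  shows "x' \<bullet> y t + x t \<bullet> y' = 0"
proof -
  have "((\<lambda>s. x s \<bullet> y s) has_vector_derivative x t \<bullet> y' + x' \<bullet> y t) (at t within {a..b})"
    using assms by (intro bounded_bilinear.has_vector_derivative[OF bounded_bilinear_inner])
  moreover have "((\<lambda>s. x s \<bullet> y s) has_vector_derivative 0) (at t within {a..b})"
    by (rule has_vector_derivative_transform[OF t const has_vector_derivative_const])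
  ultimately show ?thesis
    using vector_derivative_unique_within_closed_interval[of a b t] assms(1,2)
    by (force simp: add.commute)
qed

section \<open>Admissible variations\<close>

text \<open>Two families of variations suffice. With \<open>\<delta>q = 0\<close> the field \<open>V\<close> is itself an admissible
  \<open>\<delta>\<mu>\<close>, because it is tangent; this forces \<open>V = 0\<close>. For \<open>R\<close>, any field \<open>\<eta>\<close> vanishing at the
  ends gives \<open>\<delta>q\<^sub>i = \<eta>\<^sub>i \<times> q\<^sub>i\<close> after the part of \<open>\<eta>\<^sub>i\<close> along \<open>q\<^sub>i\<close>, which does not affect the cross
  product, is subtracted to obtain \<open>\<gamma>\<^sub>i\<close>. As
  \<open>R\<^sub>i \<bullet> (\<eta>\<^sub>i \<times> q\<^sub>i) = (q\<^sub>i \<times> R\<^sub>i) \<bullet> \<eta>\<^sub>i\<close>, the unconstrained fundamental lemma gives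
  \<open>q\<^sub>i \<times> R\<^sub>i = 0\<close>, and \<open>R\<^sub>i\<close> is orthogonal to \<open>q\<^sub>i\<close>.\<close>

lemma admissible_variations_separate:
  fixes q \<mu> V R :: "real \<Rightarrow> real^3^'n"
  assumes "t0 < tf" and q: "C1_curve t0 tf q" and \<mu>: "continuous_on {t0..tf} \<mu>"
    and unit: "\<And>t i. t \<in> {t0..tf} \<Longrightarrow> norm (q t $ i) = 1"
    and V: "continuous_on {t0..tf} V" "\<And>t. t \<in> {t0..tf} \<Longrightarrow> V t \<in> tangent_space (q t)"
    and R: "continuous_on {t0..tf} R" "\<And>t. t \<in> {t0..tf} \<Longrightarrow> R t \<in> tangent_space (q t)"
    and weak: "\<And>\<delta>q \<delta>\<mu>. admissible_variation t0 tf q \<mu> \<delta>q \<delta>\<mu> \<Longrightarrow>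
      integral {t0..tf} (\<lambda>t. V t \<bullet> \<delta>\<mu> t + R t \<bullet> \<delta>q t) = 0"
    and t: "t \<in> {t0..tf}"
  shows "V t = 0" and "R t = 0"
proof -
  let ?T = "{t0..tf}"
  have "admissible_variation t0 tf q \<mu> (\<lambda>_. 0) V"
    unfolding admissible_variation_def
    using V by (auto simp: tangent_space_def C1_curve_def intro!: exI[of _ "\<lambda>_. 0"])
  from weak[OF this] have "integral ?T (\<lambda>t. V t \<bullet> V t) = 0"
    by simp
  moreover have "continuous_on ?T (\<lambda>t. V t \<bullet> V t)"
    by (intro continuous_intros V)
  ultimately have V0: "V t = 0" if "t \<in> ?T" for t
    using integral_eq_0_iff[of t0 tf "\<lambda>t. V t \<bullet> V t"] that \<open>t0 < tf\<close> by simp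
  show "V t = 0"
    by (rule V0[OF t])
  obtain q' where q': "continuous_on ?T q'"
      "\<And>t. t \<in> ?T \<Longrightarrow> (q has_vector_derivative q' t) (at t within ?T)"
    using q unfolding C1_curve_def by blast
  have cq: "continuous_on ?T q"
    by (rule continuous_on_vector_derivative, erule q'(2))
  have qq: "q t $ i \<bullet> q t $ i = 1" if "t \<in> ?T" for t i
    using unit[OF that] by (simp add: norm_eq_1)
  define C where "C t = (\<chi> i. cross3 (q t $ i) (R t $ i))" for t
  have "C t = 0"
  proof (rule fundamental_lemma_C1[OF \<open>t0 < tf\<close> _ _ t])
    show "continuous_on ?T C"
      unfolding C_def by (intro continuous_intros cq R)
    fix \<eta> :: "real \<Rightarrow> real^3^'n"
    assume "C1_curve t0 tf \<eta>" and ends: "\<eta> t0 = 0" "\<eta> tf = 0"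
    then obtain \<eta>' where \<eta>': "continuous_on ?T \<eta>'"
        "\<And>t. t \<in> ?T \<Longrightarrow> (\<eta> has_vector_derivative \<eta>' t) (at t within ?T)"
      unfolding C1_curve_def by blast
    have c\<eta>: "continuous_on ?T \<eta>"
      by (rule continuous_on_vector_derivative, erule \<eta>'(2))
    define \<gamma> where "\<gamma> t = (\<chi> i. \<eta> t $ i - (q t $ i \<bullet> \<eta> t $ i) *\<^sub>R q t $ i)" for t
    define \<delta>q where "\<delta>q t = (\<chi> i. cross3 (\<eta> t $ i) (q t $ i))" for t
    \<comment> \<open>The purely normal \<open>\<delta>\<mu>\<close> that the linearized constraint demands.\<close>
    define \<delta>\<mu> where "\<delta>\<mu> t = (\<chi> i. - (\<delta>q t $ i \<bullet> \<mu> t $ i) *\<^sub>R q t $ i)" for t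
    have "C1_curve t0 tf \<gamma>"
    proof (rule C1_curve_vec_lambda)
      let ?d = "\<lambda>t. \<chi> i. \<eta>' t $ i - ((q t $ i \<bullet> \<eta> t $ i) *\<^sub>R q' t $ i
          + (q t $ i \<bullet> \<eta>' t $ i + q' t $ i \<bullet> \<eta> t $ i) *\<^sub>R q t $ i)"
      show "continuous_on ?T ?d"
        by (intro continuous_intros cq c\<eta> q' \<eta>')
      fix t i assume t: "t \<in> ?T"
      have d: "((\<lambda>s. q s $ i) has_vector_derivative q' t $ i) (at t within ?T)"
          "((\<lambda>s. \<eta> s $ i) has_vector_derivative \<eta>' t $ i) (at t within ?T)"
        using q'(2)[OF t] \<eta>'(2)[OF t] by (auto intro: has_vector_derivative_vec_nth)
      have "((\<lambda>s. q s $ i \<bullet> \<eta> s $ i) has_vector_derivative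
          q t $ i \<bullet> \<eta>' t $ i + q' t $ i \<bullet> \<eta> t $ i) (at t within ?T)"
        using d by (intro bounded_bilinear.has_vector_derivative[OF bounded_bilinear_inner])
      then have "((\<lambda>s. (q s $ i \<bullet> \<eta> s $ i) *\<^sub>R q s $ i) has_vector_derivative
          (q t $ i \<bullet> \<eta> t $ i) *\<^sub>R q' t $ i
          + (q t $ i \<bullet> \<eta>' t $ i + q' t $ i \<bullet> \<eta> t $ i) *\<^sub>R q t $ i) (at t within ?T)"
        using d by (intro bounded_bilinear.has_vector_derivative[OF bounded_bilinear_scaleR])
      from has_vector_derivative_diff[OF d(2) this]
      show "((\<lambda>s. \<gamma> s $ i) has_vector_derivative ?d t $ i) (at t within ?T)"
        by (simp add: \<gamma>_def)
    qed
    moreover have "\<gamma> t0 = 0" "\<gamma> tf = 0"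
      using ends by (simp_all add: \<gamma>_def blocks_eq_0_iff)
    moreover have "\<gamma> t $ i \<bullet> q t $ i = 0" "\<delta>q t $ i = cross3 (\<gamma> t $ i) (q t $ i)" if "t \<in> ?T" for t i
      using qq[OF that]
      by (simp_all add: \<gamma>_def \<delta>q_def inner_simps inner_commute Cross3.left_diff_distrib cross_mult_left)
    moreover have "continuous_on ?T \<delta>\<mu>"
      unfolding \<delta>\<mu>_def \<delta>q_def by (auto intro!: continuous_intros cq c\<eta> \<mu>)
    moreover have "\<delta>q t $ i \<bullet> \<mu> t $ i + q t $ i \<bullet> \<delta>\<mu> t $ i = 0" if "t \<in> ?T" for t i
      using qq[OF that] by (simp add: \<delta>\<mu>_def)
    ultimately have "admissible_variation t0 tf q \<mu> \<delta>q \<delta>\<mu>"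
      unfolding admissible_variation_def by blast
    from weak[OF this] have "integral ?T (\<lambda>t. V t \<bullet> \<delta>\<mu> t + R t \<bullet> \<delta>q t) = 0" .
    moreover have "C t \<bullet> \<eta> t = V t \<bullet> \<delta>\<mu> t + R t \<bullet> \<delta>q t" if "t \<in> ?T" for t
    proof -
      have "cross3 (q t $ i) (R t $ i) \<bullet> \<eta> t $ i = R t $ i \<bullet> cross3 (\<eta> t $ i) (q t $ i)" for i
        by (metis cross_triple inner_commute)
      then show ?thesis
        using V0[OF that] by (simp add: inner_blocks C_def \<delta>q_def)
    qed
    then have "integral ?T (\<lambda>t. C t \<bullet> \<eta> t) = integral ?T (\<lambda>t. V t \<bullet> \<delta>\<mu> t + R t \<bullet> \<delta>q t)"
      by (rule integral_cong)
    ultimately show "integral ?T (\<lambda>t. C t \<bullet> \<eta> t) = 0"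
      by simp
  qed
  then have "cross3 (q t $ i) (R t $ i) = 0" for i
    by (simp add: C_def blocks_eq_0_iff)
  moreover have "q t $ i \<bullet> R t $ i = 0" for i
    using R(2)[OF t] by (simp add: tangent_space_def)
  moreover have "q t $ i \<noteq> 0" for i
    using unit[OF t, of i] by auto
  ultimately show "R t = 0"
    using norm_and_cross_eq_0 by (simp add: blocks_eq_0_iff) metis
qed

section \<open>Weak form and Hamilton's equations\<close>

text \<open>The first variation exists for every admissible variation, so the principle only equates its
  value with \<open>- \<delta>W\<close>. Integration by parts turns the difference into an integral in
  which \<open>\<delta>q\<close> occurs without its derivative, and there the integrand is rewritten pointwise.\<close>

lemma phase_space_principle_iff_weak_form:
  fixes H :: "(real^3^'n) \<times> (real^3^'n) \<Rightarrow> real"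
    and q \<mu> f :: "real \<Rightarrow> real^3^'n"
  assumes "t0 < tf" and H: "C1_near cotangent_bundle H"
    and in_bundle: "\<And>t. t \<in> {t0..tf} \<Longrightarrow> (q t, \<mu> t) \<in> cotangent_bundle"
    and q: "\<And>t. t \<in> {t0..tf} \<Longrightarrow> (q has_vector_derivative q' t) (at t within {t0..tf})"
    and \<mu>: "\<And>t. t \<in> {t0..tf} \<Longrightarrow> (\<mu> has_vector_derivative \<mu>' t) (at t within {t0..tf})"
    and cont: "continuous_on {t0..tf} q'" "continuous_on {t0..tf} \<mu>'" "continuous_on {t0..tf} f"
    and grad: "continuous_on {t0..tf} (\<lambda>t. gradient H (q t, \<mu> t))"
  shows "phase_space_principle H f t0 tf q \<mu> \<longleftrightarrow>
    (\<forall>\<delta>q \<delta>\<mu>. admissible_variation t0 tf q \<mu> \<delta>q \<delta>\<mu> \<longrightarrow>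
      integral {t0..tf} (\<lambda>t. velocity_residual H (q t) (\<mu> t) (q' t) \<bullet> \<delta>\<mu> t
        + force_residual H (q t) (\<mu> t) (\<mu>' t) (f t) \<bullet> \<delta>q t) = 0)"
proof -
  let ?T = "{t0..tf}"
  have cq: "continuous_on ?T q" "continuous_on ?T \<mu>"
    by (rule continuous_on_vector_derivative, erule q \<mu>)+
  have "has_first_variation H t0 tf q \<mu> \<delta>q \<delta>\<mu> (- virtual_work f t0 tf \<delta>q) \<longleftrightarrow>
      integral ?T (\<lambda>t. velocity_residual H (q t) (\<mu> t) (q' t) \<bullet> \<delta>\<mu> t
        + force_residual H (q t) (\<mu> t) (\<mu>' t) (f t) \<bullet> \<delta>q t) = 0"
    if adm: "admissible_variation t0 tf q \<mu> \<delta>q \<delta>\<mu>" for \<delta>q \<delta>\<mu>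
  proof -
    obtain \<gamma> where \<gamma>: "C1_curve t0 tf \<gamma>" "\<gamma> t0 = 0" "\<gamma> tf = 0"
        "\<And>t i. t \<in> ?T \<Longrightarrow> \<delta>q t $ i = cross3 (\<gamma> t $ i) (q t $ i)"
      and \<delta>\<mu>: "continuous_on ?T \<delta>\<mu>"
        "\<And>t i. t \<in> ?T \<Longrightarrow> \<delta>q t $ i \<bullet> \<mu> t $ i + q t $ i \<bullet> \<delta>\<mu> t $ i = 0"
      using adm unfolding admissible_variation_def by blast
    obtain \<gamma>' where \<gamma>': "continuous_on ?T \<gamma>'"
        "\<And>t. t \<in> ?T \<Longrightarrow> (\<gamma> has_vector_derivative \<gamma>' t) (at t within ?T)"
      using \<gamma>(1) unfolding C1_curve_def by blast
    have c\<gamma>: "continuous_on ?T \<gamma>"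
      by (rule continuous_on_vector_derivative, erule \<gamma>'(2))
    define \<delta>q' where "\<delta>q' t = (\<chi> i. cross3 (\<gamma> t $ i) (q' t $ i) + cross3 (\<gamma>' t $ i) (q t $ i))" for t
    have c\<delta>q': "continuous_on ?T \<delta>q'"
      unfolding \<delta>q'_def by (intro continuous_intros c\<gamma> \<gamma>' cq cont)
    have \<delta>q': "(\<delta>q has_vector_derivative \<delta>q' t) (at t within ?T)" if t: "t \<in> ?T" for t
    proof (rule has_vector_derivative_vec_lambda)
      fix i
      have "((\<lambda>s. cross3 (\<gamma> s $ i) (q s $ i)) has_vector_derivative \<delta>q' t $ i) (at t within ?T)"
        unfolding \<delta>q'_def vec_lambda_beta
        by (intro bounded_bilinear.has_vector_derivative[OF bounded_bilinear_cross3]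
            has_vector_derivative_vec_nth q \<gamma>' t)
      then show "((\<lambda>s. \<delta>q s $ i) has_vector_derivative \<delta>q' t $ i) (at t within ?T)"
        by (rule has_vector_derivative_transform[OF t \<gamma>(4), rotated])
    qed
    have c\<delta>q: "continuous_on ?T \<delta>q"
      by (rule continuous_on_vector_derivative, erule \<delta>q')
    have ends: "\<delta>q t0 = 0" "\<delta>q tf = 0"
      using \<gamma>(2,3) \<gamma>(4)[of t0] \<gamma>(4)[of tf] \<open>t0 < tf\<close> by (simp_all add: blocks_eq_0_iff)
    note ci = integrable_continuous_real continuous_intros cq cont c\<delta>q c\<delta>q' \<delta>\<mu>(1) grad
    let ?g = "\<lambda>t. gradient H (q t, \<mu> t) \<bullet> (\<delta>q t, \<delta>\<mu> t)"
    define G where "G = integral ?T (\<lambda>t. \<delta>\<mu> t \<bullet> q' t + \<mu> t \<bullet> \<delta>q' t - ?g t)"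
    have fv: "has_first_variation H t0 tf q \<mu> \<delta>q \<delta>\<mu> G"
      unfolding G_def
      using first_variation_formula[OF \<open>t0 < tf\<close> H in_bundle q \<delta>q' cont(1) c\<delta>q' cq(2) \<delta>\<mu>(1)] .
    have W: "virtual_work f t0 tf \<delta>q = integral ?T (\<lambda>t. f t \<bullet> \<delta>q t)"
      unfolding virtual_work_def inner_blocks ..
    have "G = integral ?T (\<lambda>t. \<delta>\<mu> t \<bullet> q' t - ?g t) + integral ?T (\<lambda>t. \<mu> t \<bullet> \<delta>q' t)"
      unfolding G_def
      by (subst integral_add[symmetric]) (auto intro!: ci simp: algebra_simps)
    also have "integral ?T (\<lambda>t. \<mu> t \<bullet> \<delta>q' t) = - integral ?T (\<lambda>t. \<mu>' t \<bullet> \<delta>q t)"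
      using \<open>t0 < tf\<close> by (intro integral_by_parts_vanishing \<mu> \<delta>q' cont c\<delta>q' ends) auto
    finally have "G + virtual_work f t0 tf \<delta>q = integral ?T (\<lambda>t. \<delta>\<mu> t \<bullet> q' t - ?g t)
        - integral ?T (\<lambda>t. \<mu>' t \<bullet> \<delta>q t) + integral ?T (\<lambda>t. f t \<bullet> \<delta>q t)"
      by (simp add: W)
    also have "\<dots> = integral ?T (\<lambda>t. \<delta>\<mu> t \<bullet> q' t - ?g t - \<mu>' t \<bullet> \<delta>q t + f t \<bullet> \<delta>q t)"
      by (simp add: integral_diff integral_add ci)
    also have "\<dots> = integral ?T (\<lambda>t. velocity_residual H (q t) (\<mu> t) (q' t) \<bullet> \<delta>\<mu> t
        + force_residual H (q t) (\<mu> t) (\<mu>' t) (f t) \<bullet> \<delta>q t)"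
    proof (rule integral_cong)
      fix t assume t: "t \<in> ?T"
      have "q t $ i \<bullet> \<delta>q t $ i = 0" for i
        using \<gamma>(4)[OF t] by (simp add: dot_cross_self)
      from variation_integrand_eq_residuals[OF in_bundle[OF t] this \<delta>\<mu>(2)[OF t], of "q' t" "\<mu>' t" H "f t"]
      show "\<delta>\<mu> t \<bullet> q' t - ?g t - \<mu>' t \<bullet> \<delta>q t + f t \<bullet> \<delta>q t
          = velocity_residual H (q t) (\<mu> t) (q' t) \<bullet> \<delta>\<mu> t
            + force_residual H (q t) (\<mu> t) (\<mu>' t) (f t) \<bullet> \<delta>q t"
        by linarith
    qed
    finally have eq: "G + virtual_work f t0 tf \<delta>q = integral ?T (\<lambda>t. velocity_residual H (q t) (\<mu> t) (q' t) \<bullet> \<delta>\<mu> t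
        + force_residual H (q t) (\<mu> t) (\<mu>' t) (f t) \<bullet> \<delta>q t)" .
    have "has_first_variation H t0 tf q \<mu> \<delta>q \<delta>\<mu> (- virtual_work f t0 tf \<delta>q) \<longleftrightarrow>
        G = - virtual_work f t0 tf \<delta>q"
      using fv DERIV_unique unfolding has_first_variation_def by blast
    then show ?thesis
      unfolding eq[symmetric] by linarith
  qed
  then show ?thesis
    unfolding phase_space_principle_def by blast
qed

theorem proposition3:
  fixes L H :: "(real^3^'n) \<times> (real^3^'n) \<Rightarrow> real"
    and q \<mu> f :: "real \<Rightarrow> real^3^'n"
    and t0 tf :: real
  assumes "C1_near tangent_bundle L"
    and "legendre_invertible L"
    and "C1_near cotangent_bundle H"
    and "is_hamiltonian_of H L"
    and "t0 < tf"
    and "C1_curve t0 tf q"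
    and "C1_curve t0 tf \<mu>"
    and "\<forall>t\<in>{t0..tf}. (q t, \<mu> t) \<in> cotangent_bundle"
    and "continuous_on {t0..tf} f"
  shows "phase_space_principle H f t0 tf q \<mu> \<longleftrightarrow>
    (\<forall>t\<in>{t0..tf}. \<forall>i.
      ((\<lambda>s. q s $ i) has_vector_derivative
         proj (q t $ i) *v grad_snd H (q t, \<mu> t) i) (at t within {t0..tf}) \<and>
      ((\<lambda>s. \<mu> s $ i) has_vector_derivative
         - (proj (q t $ i) *v (grad_fst H (q t, \<mu> t) i - f t $ i))
         + cross3 (grad_snd H (q t, \<mu> t) i) (cross3 (\<mu> t $ i) (q t $ i))) (at t within {t0..tf}))"
proof -
  let ?T = "{t0..tf}"
  obtain q' where q': "continuous_on ?T q'"
      "\<And>t. t \<in> ?T \<Longrightarrow> (q has_vector_derivative q' t) (at t within ?T)"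
    using assms(6) unfolding C1_curve_def by blast
  obtain \<mu>' where \<mu>': "continuous_on ?T \<mu>'"
      "\<And>t. t \<in> ?T \<Longrightarrow> (\<mu> has_vector_derivative \<mu>' t) (at t within ?T)"
    using assms(7) unfolding C1_curve_def by blast
  note blocks = has_vector_derivative_vec_nth[OF q'(2)] has_vector_derivative_vec_nth[OF \<mu>'(2)]
  have cq: "continuous_on ?T q" "continuous_on ?T \<mu>"
    by (rule continuous_on_vector_derivative, erule q'(2) \<mu>'(2))+
  have in_bundle: "(q t, \<mu> t) \<in> cotangent_bundle" if "t \<in> ?T" for t
    using assms(8) that by blast
  have unit: "norm (q t $ i) = 1" and qq: "q t $ i \<bullet> q t $ i = 1" and q\<mu>: "q t $ i \<bullet> \<mu> t $ i = 0"
    if "t \<in> ?T" for t i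
    using in_bundle[OF that] by (auto simp: tangent_bundle_def tangent_space_def norm_eq_1)
  have qq': "q t $ i \<bullet> q' t $ i = 0" if "t \<in> ?T" for t i
    using constraint_derivative[OF \<open>t0 < tf\<close> that blocks(1)[OF that] blocks(1)[OF that] qq]
    by (simp add: inner_commute)
  have q\<mu>': "q' t $ i \<bullet> \<mu> t $ i + q t $ i \<bullet> \<mu>' t $ i = 0" if "t \<in> ?T" for t i
    using constraint_derivative[OF \<open>t0 < tf\<close> that blocks(1)[OF that] blocks(2)[OF that] q\<mu>] .
  obtain U where U: "cotangent_bundle \<subseteq> U" "continuous_on U (gradient H)"
    using assms(3) unfolding C1_near_def by blast
  have grad: "continuous_on ?T (\<lambda>t. gradient H (q t, \<mu> t))"
    by (rule continuous_on_compose2[OF U(2)])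
      (use in_bundle U(1) in \<open>auto intro!: continuous_intros cq\<close>)
  define V where "V t = velocity_residual H (q t) (\<mu> t) (q' t)" for t
  define R where "R t = force_residual H (q t) (\<mu> t) (\<mu>' t) (f t)" for t
  have V: "continuous_on ?T V" "\<And>t. t \<in> ?T \<Longrightarrow> V t \<in> tangent_space (q t)"
    and R: "continuous_on ?T R" "\<And>t. t \<in> ?T \<Longrightarrow> R t \<in> tangent_space (q t)"
    unfolding V_def R_def
    using residuals_tangent[OF in_bundle qq']
    by (auto simp: velocity_residual_def force_residual_def proj_mult_vec grad_fst_def grad_snd_def
        intro!: continuous_intros cq q' \<mu>' assms(9) grad)
  have "phase_space_principle H f t0 tf q \<mu> \<longleftrightarrow>
    (\<forall>\<delta>q \<delta>\<mu>. admissible_variation t0 tf q \<mu> \<delta>q \<delta>\<mu> \<longrightarrow>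
      integral ?T (\<lambda>t. V t \<bullet> \<delta>\<mu> t + R t \<bullet> \<delta>q t) = 0)"
    unfolding V_def R_def
    by (rule phase_space_principle_iff_weak_form[OF \<open>t0 < tf\<close> assms(3) in_bundle q'(2) \<mu>'(2) q'(1) \<mu>'(1) assms(9) grad])
  also have "\<dots> \<longleftrightarrow> (\<forall>t\<in>?T. V t = 0 \<and> R t = 0)"
  proof
    assume weak: "\<forall>\<delta>q \<delta>\<mu>. admissible_variation t0 tf q \<mu> \<delta>q \<delta>\<mu> \<longrightarrow>
      integral ?T (\<lambda>t. V t \<bullet> \<delta>\<mu> t + R t \<bullet> \<delta>q t) = 0"
    show "\<forall>t\<in>?T. V t = 0 \<and> R t = 0"
      using admissible_variations_separate[OF \<open>t0 < tf\<close> assms(6) cq(2) unit V R] weak by blast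
  next
    assume "\<forall>t\<in>?T. V t = 0 \<and> R t = 0"
    then have "integral ?T (\<lambda>t. V t \<bullet> \<delta>\<mu> t + R t \<bullet> \<delta>q t) = integral ?T (\<lambda>_. 0)" for \<delta>q \<delta>\<mu>
      by (intro integral_cong) simp
    then show "\<forall>\<delta>q \<delta>\<mu>. admissible_variation t0 tf q \<mu> \<delta>q \<delta>\<mu> \<longrightarrow>
      integral ?T (\<lambda>t. V t \<bullet> \<delta>\<mu> t + R t \<bullet> \<delta>q t) = 0"
      by simp
  qed
  also have "\<dots> \<longleftrightarrow> (\<forall>t\<in>?T. \<forall>i.
      q' t $ i = proj (q t $ i) *v grad_snd H (q t, \<mu> t) i \<and>
      \<mu>' t $ i = - (proj (q t $ i) *v (grad_fst H (q t, \<mu> t) i - f t $ i))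
         + cross3 (grad_snd H (q t, \<mu> t) i) (cross3 (\<mu> t $ i) (q t $ i)))"
    unfolding V_def R_def using residuals_eq_0_iff[OF in_bundle q\<mu>'] by (intro ball_cong refl) blast
  also have "\<dots> \<longleftrightarrow> (\<forall>t\<in>?T. \<forall>i.
      ((\<lambda>s. q s $ i) has_vector_derivative
         proj (q t $ i) *v grad_snd H (q t, \<mu> t) i) (at t within ?T) \<and>
      ((\<lambda>s. \<mu> s $ i) has_vector_derivative
         - (proj (q t $ i) *v (grad_fst H (q t, \<mu> t) i - f t $ i))
         + cross3 (grad_snd H (q t, \<mu> t) i) (cross3 (\<mu> t $ i) (q t $ i))) (at t within ?T))"
  proof -
    have deriv_iff: "x' = d \<longleftrightarrow> (x has_vector_derivative d) (at t within ?T)"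
      if "t \<in> ?T" "(x has_vector_derivative x') (at t within ?T)" for t d x' and x :: "real \<Rightarrow> real^3"
      using that vector_derivative_unique_within_closed_interval[of t0 tf t x x' d] \<open>t0 < tf\<close> by auto
    show ?thesis
      by (intro ball_cong refl all_cong1 conj_cong deriv_iff blocks)
  qed
  finally show ?thesis .
qed

end
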